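(* There is an integer-valued set function $f$ over a ground set of $70$ items that is $2$-modular and tightly $2$-linear. Hence the strong Kalton constant satisfies $K_s \ge 1$.
   Context: A set function on a finite ground set $U$ is a map $f:2^U\to\mathbb{R}$. It is $\epsilon$-modular if $|f(S)+f(T)-f(S\cup T)-f(S\cap T)|\le\epsilon$ for all $S,T\subseteq U$. It is linear if there are constants $c_0$ and $c_i$ ($i\in U$) with $f(S)=c_0+\sum_{i\in S}c_i$ for all $S$. It is $\Delta$-linear if some linear set function $\ell$ satisfies $|f(S)-\ell(S)|\le\Delta$ for all $S$; it is tightly $\Delta$-linear if it is $\Delta$-linear but not $\Delta'$-linear for any $\Delta'<\Delta$. The strong Kalton constant $K_s$ is the smallest constant such that for every $n$ and every $\epsilon\ge0$, every $\epsilon$-modular set function over $[n]$ is $K_s\epsilon$-linear. *)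

theory Defs
  imports Complex_Main "HOL-Library.Extended_Real"
begin

(* A set function on the ground set U is a function on 'a set of which only the
   values at subsets of U matter; every notion below is relativised to Pow U. *)

definition eps_modular :: "'a set \<Rightarrow> real \<Rightarrow> ('a set \<Rightarrow> real) \<Rightarrow> bool" where
  "eps_modular U \<epsilon> f \<longleftrightarrow>
     (\<forall>S T. S \<subseteq> U \<longrightarrow> T \<subseteq> U \<longrightarrow> \<bar>f S + f T - f (S \<union> T) - f (S \<inter> T)\<bar> \<le> \<epsilon>)"

definition linear_set_function :: "'a set \<Rightarrow> ('a set \<Rightarrow> real) \<Rightarrow> bool" where
  "linear_set_function U l \<longleftrightarrow>
     (\<exists>c0 c. \<forall>S. S \<subseteq> U \<longrightarrow> l S = c0 + (\<Sum>i\<in>S. c i))"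

definition delta_linear :: "'a set \<Rightarrow> real \<Rightarrow> ('a set \<Rightarrow> real) \<Rightarrow> bool" where
  "delta_linear U \<Delta> f \<longleftrightarrow>
     (\<exists>l. linear_set_function U l \<and> (\<forall>S. S \<subseteq> U \<longrightarrow> \<bar>f S - l S\<bar> \<le> \<Delta>))"

definition tightly_delta_linear :: "'a set \<Rightarrow> real \<Rightarrow> ('a set \<Rightarrow> real) \<Rightarrow> bool" where
  "tightly_delta_linear U \<Delta> f \<longleftrightarrow>
     delta_linear U \<Delta> f \<and> (\<forall>\<Delta>'<\<Delta>. \<not> delta_linear U \<Delta>' f)"

definition integer_valued :: "'a set \<Rightarrow> ('a set \<Rightarrow> real) \<Rightarrow> bool" where
  "integer_valued U f \<longleftrightarrow> (\<forall>S. S \<subseteq> U \<longrightarrow> f S \<in> \<int>)"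

definition strong_Kalton_bound :: "real \<Rightarrow> bool" where
  "strong_Kalton_bound K \<longleftrightarrow>
     (\<forall>(n::nat) \<epsilon> (f :: nat set \<Rightarrow> real).
        \<epsilon> \<ge> 0 \<longrightarrow> eps_modular {1..n} \<epsilon> f \<longrightarrow> delta_linear {1..n} (K * \<epsilon>) f)"

(* The smallest admissible constant, as an infimum in the extended reals: the
   value is infinity if no constant is admissible, so a lower bound on it says
   exactly that every admissible constant obeys that bound.  (The real-valued
   infimum would be unspecified in that case.) *)
definition strong_Kalton_constant :: ereal where
  "strong_Kalton_constant = Inf (ereal ` {K. strong_Kalton_bound K})"

end

(* Take the 70 four-element subsets of {0..7} as items, let P i be the set of items containing i and
   N i its complement.  Put f = 2 on each P i, f = -2 on each N i, f = 1 on the sets lying between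
   P k \<inter> P l and P k or between P k and P k \<union> P l, f = -1 on the analogous sets for N, and f = 0
   elsewhere.  Any four indices can be prescribed to lie all inside or all outside an item, so comparable
   sets never get values of opposite sign; this makes f 2-modular.  Every item lies in four of the P i and
   in four of the N i, so the values of a linear function over the P i and over the N i have the same sum,
   and it must miss one of the values of f by at least 2. *)
theory Submission imports Defs begin

section \<open>Indexed set families and the score built from two of them\<close>

definition near :: "'i set \<Rightarrow> ('i \<Rightarrow> 'a set) \<Rightarrow> 'a set \<Rightarrow> bool" where
  "near I F S \<longleftrightarrow> (\<exists>k\<in>I. \<exists>l\<in>I.
     F k \<inter> F l \<subseteq> S \<and> S \<subseteq> F k \<or> F k \<subseteq> S \<and> S \<subseteq> F k \<union> F l)"

text \<open>Members of a family are themselves near it (take k = l), so the membership terms add to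
  the nearness terms: this yields the values 2 and -2 on members and 1 and -1 on the other near
  sets, provided that no set is near both families.\<close>

definition score :: "'i set \<Rightarrow> ('i \<Rightarrow> 'a set) \<Rightarrow> ('i \<Rightarrow> 'a set) \<Rightarrow> 'a set \<Rightarrow> real" where
  "score I P N S =
     of_bool (near I P S) + of_bool (S \<in> P ` I) - of_bool (near I N S) - of_bool (S \<in> N ` I)"

text \<open>This forces an interval that bounds a near set to involve a given member as soon as the
  near set and that member are suitably nested.\<close>

definition spread :: "'i set \<Rightarrow> ('i \<Rightarrow> 'a set) \<Rightarrow> bool" where
  "spread I F \<longleftrightarrow> (\<forall>i\<in>I. \<forall>k\<in>I. \<forall>l\<in>I.
     (F k \<inter> F l \<subseteq> F i \<longrightarrow> i = k \<or> i = l) \<and> (F i \<subseteq> F k \<union> F l \<longrightarrow> i = k \<or> i = l))"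

text \<open>Sets near \<open>F\<close> contain some F k \<inter> F l, and sets near \<open>G\<close>
  lie in some G p \<union> G q, so this excludes inclusions from the former into the latter.\<close>

definition separated :: "'i set \<Rightarrow> ('i \<Rightarrow> 'a set) \<Rightarrow> ('i \<Rightarrow> 'a set) \<Rightarrow> bool" where
  "separated I F G \<longleftrightarrow> (\<forall>k\<in>I. \<forall>l\<in>I. \<forall>p\<in>I. \<forall>q\<in>I. \<not> F k \<inter> F l \<subseteq> G p \<union> G q)"

section \<open>Near sets under inclusion, union and intersection\<close>

lemma near_member: "i \<in> I \<Longrightarrow> near I F (F i)"
  unfolding near_def by blast

lemma near_image: "S \<in> F ` I \<Longrightarrow> near I F S"
  by (auto intro: near_member)

lemma not_near_both:
  assumes "separated I F G" "near I F S" "near I G T"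
  shows "\<not> S \<subseteq> T"
proof
  assume "S \<subseteq> T"
  obtain k l where "k \<in> I" "l \<in> I" "F k \<inter> F l \<subseteq> S"
    using assms(2) unfolding near_def by blast
  moreover obtain p q where "p \<in> I" "q \<in> I" "T \<subseteq> G p \<union> G q"
    using assms(3) unfolding near_def by blast
  ultimately show False
    using assms(1) \<open>S \<subseteq> T\<close> unfolding separated_def by blast
qed

text \<open>The intersection F k \<inter> F l below A \<inter> B is also below the member F i = A
  \<union> B, so \<open>spread\<close> makes i equal to k or l. Then \<open>A\<close> and
  \<open>B\<close> are squeezed between F k \<inter> F l and F i.\<close>

lemma near_of_union_member:
  assumes "spread I F" "A \<union> B \<in> F ` I" "near I F (A \<inter> B)"
  shows "near I F A \<and> near I F B"
proof -
  obtain i where i: "i \<in> I" "A \<union> B = F i"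
    using assms(2) by blast
  obtain k l where kl: "k \<in> I" "l \<in> I"
    and "F k \<inter> F l \<subseteq> A \<inter> B \<and> A \<inter> B \<subseteq> F k \<or> F k \<subseteq> A \<inter> B \<and> A \<inter> B \<subseteq> F k \<union> F l"
    using assms(3) unfolding near_def by blast
  then have sub: "F k \<inter> F l \<subseteq> A \<inter> B" by blast
  then have "i = k \<or> i = l"
    using assms(1) i kl sub unfolding spread_def by blast
  then show ?thesis
    unfolding near_def using i(2) kl sub by blast
qed

lemma near_of_inter_member:
  assumes "spread I F" "A \<inter> B \<in> F ` I" "near I F (A \<union> B)"
  shows "near I F A \<and> near I F B"
proof -
  obtain i where i: "i \<in> I" "A \<inter> B = F i"
    using assms(2) by blast
  obtain k l where kl: "k \<in> I" "l \<in> I"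
    and "F k \<inter> F l \<subseteq> A \<union> B \<and> A \<union> B \<subseteq> F k \<or> F k \<subseteq> A \<union> B \<and> A \<union> B \<subseteq> F k \<union> F l"
    using assms(3) unfolding near_def by blast
  then have sub: "A \<union> B \<subseteq> F k \<union> F l" by blast
  then have "i = k \<or> i = l"
    using assms(1) i kl sub unfolding spread_def by blast
  then show ?thesis
    unfolding near_def using i(2) kl sub by blast
qed

text \<open>A near set is comparable with some F p: if it lies below, the union with F i stays under
  F i \<union> F p; if above, the intersection with F i stays over F i \<inter> F p.\<close>

lemma near_union_or_inter:
  assumes "S \<in> F ` I" "near I F B"
  shows "near I F (S \<union> B) \<or> near I F (S \<inter> B)"
proof -
  obtain i where i: "i \<in> I" "S = F i"
    using assms(1) by blast
  obtain p q where pq: "p \<in> I" "q \<in> I"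
    and "F p \<inter> F q \<subseteq> B \<and> B \<subseteq> F p \<or> F p \<subseteq> B \<and> B \<subseteq> F p \<union> F q"
    using assms(2) unfolding near_def by blast
  then consider "B \<subseteq> F p" | "F p \<subseteq> B" by blast
  then show ?thesis
  proof cases
    case 1
    then have "F i \<subseteq> F i \<union> B \<and> F i \<union> B \<subseteq> F i \<union> F p" by blast
    then show ?thesis unfolding near_def using i pq by blast
  next
    case 2
    then have "F i \<inter> F p \<subseteq> F i \<inter> B \<and> F i \<inter> B \<subseteq> F i" by blast
    then show ?thesis unfolding near_def using i pq by blast
  qed
qed

lemma near_union_and_inter:
  assumes "S \<in> F ` I" "T \<in> F ` I"
  shows "near I F (S \<union> T)" "near I F (S \<inter> T)"
proof -
  obtain i j where ij: "i \<in> I" "S = F i" "j \<in> I" "T = F j"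
    using assms by blast
  then have "F i \<subseteq> S \<union> T" "S \<union> T \<subseteq> F i \<union> F j" "F i \<inter> F j \<subseteq> S \<inter> T" "S \<inter> T \<subseteq> F i"
    by blast+
  then show "near I F (S \<union> T)" "near I F (S \<inter> T)"
    unfolding near_def using ij(1,3) by blast+
qed

section \<open>Bounds on the score\<close>

lemma abs_score_le: "\<bar>score I P N S\<bar> \<le> 2"
  unfolding score_def by auto

lemma score_Ints: "score I P N S \<in> \<int>"
  unfolding score_def by auto

lemma score_le_0: "\<not> near I P S \<Longrightarrow> score I P N S \<le> 0"
  using near_image[of S P I] unfolding score_def by auto

lemma score_le_1: "S \<notin> P ` I \<Longrightarrow> score I P N S \<le> 1"
  unfolding score_def by auto

lemma score_ge_1:
  assumes "separated I P N" "near I P S"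
  shows "1 \<le> score I P N S"
proof -
  have "\<not> near I N S" using not_near_both[OF assms] by blast
  then show ?thesis
    using assms(2) near_image[of S N I] unfolding score_def by auto
qed

text \<open>This symmetry turns each upper bound on the score into a lower bound with the families
  exchanged.\<close>

lemma score_swap: "score I N P S = - score I P N S"
  unfolding score_def by simp

lemma score_ge_0: "\<not> near I N S \<Longrightarrow> 0 \<le> score I P N S"
  using score_le_0[of I N S P] by (simp add: score_swap[of I N P])

lemma score_ge_minus_1: "S \<notin> N ` I \<Longrightarrow> -1 \<le> score I P N S"
  using score_le_1[of S N I P] by (simp add: score_swap[of I N P])

lemma score_le_minus_1:
  "separated I N P \<Longrightarrow> near I N S \<Longrightarrow> score I P N S \<le> -1"
  using score_ge_1[of I N P S] by (simp add: score_swap[of I N P])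

section \<open>Approximate modularity of the score\<close>

lemma score_supermodular_upto:
  assumes "spread I P" "separated I P N" "separated I N P"
  shows "score I P N (A \<union> B) + score I P N (A \<inter> B) \<le> score I P N A + score I P N B + 2"
proof -
  let ?s = "score I P N" and ?U = "A \<union> B" and ?V = "A \<inter> B"
  have bound: "-2 \<le> ?s S" "?s S \<le> 2" for S
    using abs_score_le[of I P N S] by (simp_all add: abs_le_iff)
  show ?thesis
  proof (cases "near I P ?U \<or> near I P ?V")
    case True
    \<comment> \<open>Both \<open>A\<close> and \<open>B\<close> are comparable with the union and
      with the intersection, so neither can be near the opposite family.\<close>
    then have "\<not> near I N A" "\<not> near I N B"
      using not_near_both[OF assms(2), of ?V A] not_near_both[OF assms(2), of ?V B]
        not_near_both[OF assms(3), of A ?U] not_near_both[OF assms(3), of B ?U] by auto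
    then have nonneg: "0 \<le> ?s A" "0 \<le> ?s B"
      by (simp_all add: score_ge_0)
    \<comment> \<open>If both are near and one of them is a member, then \<open>A\<close> and
      \<open>B\<close> are near too. The left side is at most 2 in the first two cases; in the third
      it is at most 4 while the scores of \<open>A\<close> and \<open>B\<close> are at least 1
      each.\<close>
    consider (one) "\<not> near I P ?U \<or> \<not> near I P ?V"
      | (outer) "?U \<notin> P ` I" "?V \<notin> P ` I"
      | (inner) "near I P A" "near I P B"
      using near_of_union_member[OF assms(1)] near_of_inter_member[OF assms(1)] by blast
    then show ?thesis
    proof cases
      case one
      then show ?thesis
        using score_le_0[of I P ?U N] score_le_0[of I P ?V N] bound(2)[of ?U] bound(2)[of ?V] nonneg
        by linarith
    next
      case outer
      then show ?thesis
        using score_le_1[of ?U P I N] score_le_1[of ?V P I N] nonneg by linarith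
    next
      case inner
      then show ?thesis
        using score_ge_1[OF assms(2), of A] score_ge_1[OF assms(2), of B]
          bound(2)[of ?U] bound(2)[of ?V] by linarith
    qed
  next
    case False
    then have nonpos: "?s ?U \<le> 0" "?s ?V \<le> 0"
      by (simp_all add: score_le_0)
    \<comment> \<open>The left side is now at most 0, so the inequality is in doubt only if the
      scores of \<open>A\<close> and \<open>B\<close> add up to less than -2, which requires a
      member of \<open>N\<close>. This is the case of exactly one member, stated for generic sets so
      that \<open>A\<close> and \<open>B\<close> can take either role.\<close>
    have mixed: "?s (S \<union> T) + ?s (S \<inter> T) \<le> ?s S + ?s T + 2"
      if S: "S \<in> N ` I" and T: "T \<notin> N ` I" and "?s (S \<union> T) \<le> 0" "?s (S \<inter> T) \<le> 0" for S T
    proof (cases "near I N T")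
      case True
      \<comment> \<open>Here the two scores may add up to -3, so a single -1 on the left
        suffices.\<close>
      then have "near I N (S \<union> T) \<or> near I N (S \<inter> T)"
        by (rule near_union_or_inter[OF S])
      then have "?s (S \<union> T) + ?s (S \<inter> T) \<le> -1"
        using score_le_minus_1[OF assms(3), of "S \<union> T"] score_le_minus_1[OF assms(3), of "S \<inter> T"]
          that(3,4) by linarith
      then show ?thesis
        using bound(1)[of S] score_ge_minus_1[OF T, of P] by linarith
    next
      case False
      then show ?thesis
        using bound(1)[of S] score_ge_0[OF False, of P] that(3,4) by linarith
    qed
    consider (both) "A \<in> N ` I" "B \<in> N ` I" | (left) "A \<in> N ` I" "B \<notin> N ` I"
      | (right) "B \<in> N ` I" "A \<notin> N ` I" | (none) "A \<notin> N ` I" "B \<notin> N ` I"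
      by blast
    then show ?thesis
    proof cases
      case both
      \<comment> \<open>The two scores may add up to -4, so both the union and the intersection have
        to contribute -1.\<close>
      then have "near I N ?U" "near I N ?V"
        by (rule near_union_and_inter)+
      then show ?thesis
        using score_le_minus_1[OF assms(3), of ?U] score_le_minus_1[OF assms(3), of ?V]
          bound(1)[of A] bound(1)[of B] by linarith
    next
      case left
      then show ?thesis using mixed[of A B] nonpos by simp
    next
      case right
      then show ?thesis using mixed[of B A] nonpos by (simp add: Un_commute Int_commute)
    next
      case none
      then show ?thesis
        using score_ge_minus_1[of A N I P] score_ge_minus_1[of B N I P] nonpos by linarith
    qed
  qed
qed

text \<open>The previous inequality is one side of the absolute value; exchanging the families
  negates the score and gives the other side.\<close>

lemma eps_modular_score:
  assumes "spread I P" "spread I N" "separated I P N" "separated I N P"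
  shows "eps_modular U 2 (score I P N)"
  unfolding eps_modular_def
proof (intro allI impI)
  fix S T
  show "\<bar>score I P N S + score I P N T - score I P N (S \<union> T) - score I P N (S \<inter> T)\<bar> \<le> 2"
    using score_supermodular_upto[OF assms(1,3,4), of S T]
      score_supermodular_upto[OF assms(2,4,3), of S T]
    unfolding score_swap[of I N P] by linarith
qed

section \<open>Distance from linear functions\<close>

lemma score_first_member:
  assumes "separated I P N" "i \<in> I"
  shows "score I P N (P i) = 2"
proof -
  have "near I P (P i)" using assms(2) by (rule near_member)
  moreover have "\<not> near I N (P i)"
    using not_near_both[OF assms(1) \<open>near I P (P i)\<close>] by blast
  ultimately show ?thesis
    using assms(2) near_image[of "P i" N I] unfolding score_def by auto
qed

lemma score_second_member:
  assumes "separated I N P" "i \<in> I"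
  shows "score I P N (N i) = -2"
  using score_first_member[OF assms] by (simp add: score_swap[of I N P])

text \<open>Double counting: each coefficient c x occurs once for every member containing x, hence d
  times.\<close>

lemma sum_linear_members:
  fixes c0 :: real and c :: "'a \<Rightarrow> real"
  assumes "finite U" "finite I" "\<And>i. i \<in> I \<Longrightarrow> F i \<subseteq> U"
    and deg: "\<And>x. x \<in> U \<Longrightarrow> card {i\<in>I. x \<in> F i} = d"
  shows "(\<Sum>i\<in>I. c0 + (\<Sum>x\<in>F i. c x)) = card I * c0 + d * (\<Sum>x\<in>U. c x)"
proof -
  have "(\<Sum>i\<in>I. \<Sum>x\<in>F i. c x) = (\<Sum>i\<in>I. \<Sum>x\<in>{x\<in>U. x \<in> F i}. c x)"
    using assms(3) by (intro sum.cong refl) blast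
  also have "\<dots> = (\<Sum>x\<in>U. \<Sum>i\<in>{i\<in>I. x \<in> F i}. c x)"
    using assms(1,2) by (rule sum.swap_restrict[OF _ _, symmetric])
  also have "\<dots> = d * (\<Sum>x\<in>U. c x)"
    using deg by (simp add: sum_distrib_left)
  finally show ?thesis by (simp add: sum.distrib)
qed

text \<open>Equal degrees give l the same total over both families. Closeness forces l (P i) \<ge> 2
  - \<Delta> and l (N i) \<le> \<Delta> - 2, and summing over the nonempty index set compares these
  two bounds.\<close>

lemma delta_linear_score_ge:
  assumes fin: "finite U" "finite I" "I \<noteq> {}"
    and PU: "\<And>i. i \<in> I \<Longrightarrow> P i \<subseteq> U" and NU: "\<And>i. i \<in> I \<Longrightarrow> N i \<subseteq> U"
    and degP: "\<And>x. x \<in> U \<Longrightarrow> card {i\<in>I. x \<in> P i} = d"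
    and degN: "\<And>x. x \<in> U \<Longrightarrow> card {i\<in>I. x \<in> N i} = d"
    and sep: "separated I P N" "separated I N P"
    and lin: "delta_linear U \<Delta> (score I P N)"
  shows "2 \<le> \<Delta>"
proof -
  obtain l where l: "linear_set_function U l"
    and close: "\<And>S. S \<subseteq> U \<Longrightarrow> \<bar>score I P N S - l S\<bar> \<le> \<Delta>"
    using lin unfolding delta_linear_def by blast
  then obtain c0 c where c: "\<And>S. S \<subseteq> U \<Longrightarrow> l S = c0 + (\<Sum>x\<in>S. c x)"
    unfolding linear_set_function_def by blast
  have "(\<Sum>i\<in>I. l (P i)) = (\<Sum>i\<in>I. c0 + (\<Sum>x\<in>P i. c x))"
    using c PU by simp
  also have "\<dots> = (\<Sum>i\<in>I. c0 + (\<Sum>x\<in>N i. c x))"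
    using sum_linear_members[OF fin(1,2) PU degP] sum_linear_members[OF fin(1,2) NU degN] by simp
  also have "\<dots> = (\<Sum>i\<in>I. l (N i))"
    using c NU by simp
  finally have eq: "(\<Sum>i\<in>I. l (P i)) = (\<Sum>i\<in>I. l (N i))" .
  have "2 - \<Delta> \<le> l (P i)" "l (N i) \<le> \<Delta> - 2" if "i \<in> I" for i
    using close[OF PU[OF that]] close[OF NU[OF that]]
      score_first_member[OF sep(1) that] score_second_member[OF sep(2) that] by linarith+
  then have "(\<Sum>i\<in>I. 2 - \<Delta>) \<le> (\<Sum>i\<in>I. l (P i))" "(\<Sum>i\<in>I. l (N i)) \<le> (\<Sum>i\<in>I. \<Delta> - 2)"
    by (blast intro: sum_mono)+
  then have "real (card I) * (2 - \<Delta>) \<le> real (card I) * (\<Delta> - 2)"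
    using eq by simp
  moreover have "card I > 0" using fin by (simp add: card_gt_0_iff)
  ultimately show ?thesis by simp
qed

lemma tightly_delta_linear_score:
  assumes "finite U" "finite I" "I \<noteq> {}"
    and "\<And>i. i \<in> I \<Longrightarrow> P i \<subseteq> U" "\<And>i. i \<in> I \<Longrightarrow> N i \<subseteq> U"
    and "\<And>x. x \<in> U \<Longrightarrow> card {i\<in>I. x \<in> P i} = d" "\<And>x. x \<in> U \<Longrightarrow> card {i\<in>I. x \<in> N i} = d"
    and "separated I P N" "separated I N P"
  shows "tightly_delta_linear U 2 (score I P N)"
proof -
  \<comment> \<open>The zero function already attains distance 2, as the score never exceeds 2 in
    absolute value.\<close>
  have "linear_set_function U (\<lambda>S. 0)"
    unfolding linear_set_function_def by (intro exI[of _ 0] exI[of _ "\<lambda>_. 0"]) simp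
  then have "delta_linear U 2 (score I P N)"
    unfolding delta_linear_def by (intro exI[of _ "\<lambda>S. 0"]) (simp add: abs_score_le)
  moreover have "2 \<le> \<Delta>" if "delta_linear U \<Delta> (score I P N)" for \<Delta>
    using delta_linear_score_ge[OF assms that] .
  ultimately show ?thesis
    unfolding tightly_delta_linear_def by force
qed

section \<open>The instance from four-element subsets of an eight-element set\<close>

lemma exists_subset_including_avoiding:
  assumes "finite V" "K \<subseteq> V" "L \<subseteq> V" "K \<inter> L = {}" "card K \<le> m" "card L + m \<le> card V"
  shows "\<exists>T. K \<subseteq> T \<and> T \<subseteq> V - L \<and> card T = m"
proof -
  have fin: "finite L" using assms(1,3) finite_subset by blast
  have "card (V - L) = card V - card L"
    using assms fin by (simp add: card_Diff_subset)
  then have "m \<le> card (V - L)" "K \<subseteq> V - L"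
    using assms by auto
  then obtain T where "K \<subseteq> T" "T \<subseteq> V - L" "card T = m"
    using exists_subset_between[OF assms(5)] assms(1) by (metis finite_Diff)
  then show ?thesis by blast
qed

lemma exists_score_instance:
  "\<exists>P N :: nat \<Rightarrow> nat set.
     spread {..<8} P \<and> spread {..<8} N \<and> separated {..<8} P N \<and> separated {..<8} N P \<and>
     tightly_delta_linear {1..70} 2 (score {..<8} P N)"
proof -
  let ?I = "{..<8::nat}" and ?U = "{1..70::nat}"
  let ?Q = "{T. T \<subseteq> ?I \<and> card T = 4}"
  have "card ?Q = 70"
    by (simp add: n_subsets binomial_fact' fact_numeral)
  moreover have "finite ?Q" by simp
  \<comment> \<open>The numbers 1 to 70 serve as names of the four-element subsets; \<open>h\<close>
    decodes them.\<close>
  ultimately obtain h where h: "bij_betw h ?U ?Q"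
    using finite_same_card_bij[of ?U ?Q] by auto
  define P where "P i = {x\<in>?U. i \<in> h x}" for i
  define N where "N i = {x\<in>?U. i \<notin> h x}" for i
  \<comment> \<open>An item has four indices inside and four outside, so up to four of each can be
    prescribed.\<close>
  have pick: "\<exists>x\<in>?U. K \<subseteq> h x \<and> L \<inter> h x = {}"
    if KL: "K \<subseteq> ?I" "L \<subseteq> ?I" "K \<inter> L = {}" "card K \<le> 4" "card L \<le> 4" for K L
  proof -
    obtain T where "K \<subseteq> T" "T \<subseteq> ?I - L" "card T = 4"
      using exists_subset_including_avoiding[of ?I K L 4] KL by auto
    moreover from this have "T \<in> h ` ?U"
      using h unfolding bij_betw_def by blast
    ultimately show ?thesis by blast
  qed
  \<comment> \<open>The indices may coincide, so only an upper bound on the cardinality is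
    available.\<close>
  have c4: "card {a, b, c, d} \<le> 4" for a b c d :: nat
    by (simp add: card_insert_if)
  have c2: "card {a, b} \<le> 4" for a b :: nat
    using c4[of a b b b] by simp
  \<comment> \<open>The two witnesses refute the two inclusions in \<open>spread\<close>;
    complementation exchanges their roles for \<open>N\<close>.\<close>
  have split: "\<exists>x\<in>?U. k \<in> h x \<and> l \<in> h x \<and> i \<notin> h x" "\<exists>x\<in>?U. k \<notin> h x \<and> l \<notin> h x \<and> i \<in> h x"
    if "i \<in> ?I" "k \<in> ?I" "l \<in> ?I" "\<not> (i = k \<or> i = l)" for i k l
    using that pick[of "{k, l}" "{i}"] pick[of "{i}" "{k, l}"] c2 by auto
  have uniform: "\<exists>x\<in>?U. k \<in> h x \<and> l \<in> h x \<and> p \<in> h x \<and> q \<in> h x"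
    "\<exists>x\<in>?U. k \<notin> h x \<and> l \<notin> h x \<and> p \<notin> h x \<and> q \<notin> h x"
    if "k \<in> ?I" "l \<in> ?I" "p \<in> ?I" "q \<in> ?I" for k l p q
    using that pick[of "{k, l, p, q}" "{}"] pick[of "{}" "{k, l, p, q}"] c4 by auto
  have spreads: "spread ?I P" "spread ?I N"
    unfolding spread_def P_def N_def using split by blast+
  have seps: "separated ?I P N" "separated ?I N P"
    unfolding separated_def P_def N_def using uniform by blast+
  have hQ: "h x \<subseteq> ?I" "card (h x) = 4" if "x \<in> ?U" for x
    using h that unfolding bij_betw_def by blast+
  \<comment> \<open>The degrees in \<open>P\<close> and \<open>N\<close> agree because four is half
    of eight.\<close>
  have "card {i\<in>?I. x \<in> P i} = 4" "card {i\<in>?I. x \<in> N i} = 4" if "x \<in> ?U" for x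
  proof -
    have "{i\<in>?I. x \<in> P i} = h x" "{i\<in>?I. x \<in> N i} = ?I - h x"
      using hQ(1)[OF that] that unfolding P_def N_def by auto
    then show "card {i\<in>?I. x \<in> P i} = 4" "card {i\<in>?I. x \<in> N i} = 4"
      using hQ[OF that] by (simp_all add: card_Diff_subset finite_subset)
  qed
  then have "tightly_delta_linear ?U 2 (score ?I P N)"
    using seps by (intro tightly_delta_linear_score[where d = 4])
      (auto simp: P_def N_def lessThan_empty_iff)
  then show ?thesis using spreads seps by blast
qed

theorem theorem2:
  "(\<exists>f :: nat set \<Rightarrow> real.
      integer_valued {1..70} f \<and>
      eps_modular {1..70} 2 f \<and>
      tightly_delta_linear {1..70} 2 f) \<and>
   strong_Kalton_constant \<ge> 1"
proof -
  obtain P N :: "nat \<Rightarrow> nat set" where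
    fam: "spread {..<8} P" "spread {..<8} N" "separated {..<8} P N" "separated {..<8} N P"
    and tight: "tightly_delta_linear {1..70} 2 (score {..<8} P N)"
    using exists_score_instance by blast
  define f where "f = score {..<8} P N"
  have int: "integer_valued {1..70} f"
    unfolding integer_valued_def f_def by (simp add: score_Ints)
  have mod: "eps_modular {1..70} 2 f"
    unfolding f_def using fam by (rule eps_modular_score)
  have "1 \<le> K" if "strong_Kalton_bound K" for K
  proof -
    \<comment> \<open>The bound is applied with n = 70 and \<epsilon> = 2; tightness then forbids K
      * 2 < 2.\<close>
    have "delta_linear {1..70} (K * 2) f"
      using that mod unfolding strong_Kalton_bound_def by simp
    then have "\<not> K * 2 < 2"
      using tight unfolding tightly_delta_linear_def f_def by blast
    then show ?thesis by simp
  qed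
  then have "strong_Kalton_constant \<ge> 1"
    unfolding strong_Kalton_constant_def by (intro Inf_greatest) (auto simp: one_ereal_def)
  then show ?thesis
    using int mod tight unfolding f_def by blast
qed

end
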